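(* Let $\mathcal{C}$ be a tensor category satisfying Condition C (defined in the context), and let $A,B\in\mathcal{C}^b$. Then $(A\otimes B^* )^*\cong B\otimes A^*$.
   Context: A tensor category is a (not necessarily strict) monoidal category $(\mathcal{C},\otimes,\mathbf{1},\alpha,\lambda,\rho)$ with $\alpha_{U,V,W}:U\otimes(V\otimes W)\to(U\otimes V)\otimes W$, $\lambda_U:\mathbf{1}\otimes U\to U$, $\rho_U:U\otimes\mathbf{1}\to U$. "Injective" means monomorphism. Condition C: $\mathcal{C}$ is equipped with a contravariant involutive functor $(-)^*:\mathcal{C}\to\mathcal{C}$, i.e. there is a natural isomorphism $\delta_U:U\to U^{**}$, and with isomorphisms $\pi_{U,V}:\mathrm{Hom}(U,V^* )\to\mathrm{Hom}(U\otimes V,\mathbf{1}^* )$ natural in $U$ and $V$. Right dual of $U$: an object $U^\vee$ with morphisms $b_U:\mathbf{1}\to U\otimes U^\vee$, $d_U:U^\vee\otimes U\to\mathbf{1}$ such that $\rho_U\circ(\mathrm{id}_U\otimes d_U)\circ\alpha^{-1}_{U,U^\vee,U}\circ(b_U\otimes\mathrm{id}_U)\circ\lambda_U^{-1}=\mathrm{id}_U$ and $\lambda_{U^\vee}\circ(d_U\otimes\mathrm{id}_{U^\vee})\circ\alpha_{U^\vee,U,U^\vee}\circ(\mathrm{id}_{U^\vee}\otimes b_U)\circ\rho^{-1}_{U^\vee}=\mathrm{id}_{U^\vee}$. Left dual of $U$: an object ${}^\vee U$ with morphisms $\tilde b_U:\mathbf{1}\to{}^\vee U\otimes U$, $\tilde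 d_U:U\otimes{}^\vee U\to\mathbf{1}$ satisfying the analogous two zig-zag identities. $\mathcal{C}^b$ is the subcategory of $\mathcal{C}$ consisting of all objects $U$ for which $U^*$ is both a right dual and a left dual of $U$ (for some choice of duality morphisms), and for which both $b_U:\mathbf{1}\to U\otimes U^*$ and $\tilde b_U:\mathbf{1}\to U^*\otimes U$ are injective. *)

theory Defs
  imports Main
begin

section \<open>Categories\<close>

text \<open>The fields \<open>Dom\<close>, \<open>Cod\<close>, \<open>Id\<close>, \<open>Comp\<close> are total functions; only their
  values on objects, arrows and composable pairs are constrained.
  \<open>g \<cdot>\<^bsub>C\<^esub> f\<close> is composition in the usual order (first \<open>f\<close>, then \<open>g\<close>).\<close>

record ('o, 'a) category =
  Obj :: "'o set"
  Arr :: "'a set"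
  Dom :: "'a \<Rightarrow> 'o"
  Cod :: "'a \<Rightarrow> 'o"
  Id :: "'o \<Rightarrow> 'a"  ("\<i>\<d>\<index>")
  Comp :: "'a \<Rightarrow> 'a \<Rightarrow> 'a"  (infixr "\<cdot>\<index>" 60)

definition Hom :: "('o, 'a, 'm) category_scheme \<Rightarrow> 'o \<Rightarrow> 'o \<Rightarrow> 'a set" where
  "Hom C U V = {f \<in> Arr C. Dom C f = U \<and> Cod C f = V}"

locale category =
  fixes C :: "('o, 'a, 'm) category_scheme" (structure)
  assumes dom_obj: "f \<in> Arr C \<Longrightarrow> Dom C f \<in> Obj C"
    and cod_obj: "f \<in> Arr C \<Longrightarrow> Cod C f \<in> Obj C"
    and id_hom: "U \<in> Obj C \<Longrightarrow> \<i>\<d> U \<in> Hom C U U"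
    and comp_hom: "\<lbrakk>f \<in> Hom C U V; g \<in> Hom C V W\<rbrakk> \<Longrightarrow> g \<cdot> f \<in> Hom C U W"
    and id_right: "f \<in> Hom C U V \<Longrightarrow> f \<cdot> \<i>\<d> U = f"
    and id_left: "f \<in> Hom C U V \<Longrightarrow> \<i>\<d> V \<cdot> f = f"
    and comp_assoc: "\<lbrakk>f \<in> Hom C U V; g \<in> Hom C V W; h \<in> Hom C W X\<rbrakk>
      \<Longrightarrow> (h \<cdot> g) \<cdot> f = h \<cdot> (g \<cdot> f)"

definition inverse_arrows :: "('o, 'a, 'm) category_scheme \<Rightarrow> 'a \<Rightarrow> 'a \<Rightarrow> bool" where
  "inverse_arrows C f g \<longleftrightarrow> f \<in> Arr C \<and> g \<in> Hom C (Cod C f) (Dom C f) \<and>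
     g \<cdot>\<^bsub>C\<^esub> f = \<i>\<d>\<^bsub>C\<^esub> (Dom C f) \<and> f \<cdot>\<^bsub>C\<^esub> g = \<i>\<d>\<^bsub>C\<^esub> (Cod C f)"

definition iso_arrow :: "('o, 'a, 'm) category_scheme \<Rightarrow> 'a \<Rightarrow> bool" where
  "iso_arrow C f \<longleftrightarrow> (\<exists>g. inverse_arrows C f g)"

definition inverse_arrow :: "('o, 'a, 'm) category_scheme \<Rightarrow> 'a \<Rightarrow> 'a"  ("inv\<index> _" [81] 80) where
  "inv\<^bsub>C\<^esub> f = (THE g. inverse_arrows C f g)"

definition isomorphic :: "('o, 'a, 'm) category_scheme \<Rightarrow> 'o \<Rightarrow> 'o \<Rightarrow> bool"  (infix "\<cong>\<index>" 50) where
  "U \<cong>\<^bsub>C\<^esub> V \<longleftrightarrow> (\<exists>f \<in> Hom C U V. iso_arrow C f)"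

definition monomorphism :: "('o, 'a, 'm) category_scheme \<Rightarrow> 'a \<Rightarrow> bool" where
  "monomorphism C f \<longleftrightarrow> f \<in> Arr C \<and>
     (\<forall>W \<in> Obj C. \<forall>g \<in> Hom C W (Dom C f). \<forall>h \<in> Hom C W (Dom C f).
        f \<cdot>\<^bsub>C\<^esub> g = f \<cdot>\<^bsub>C\<^esub> h \<longrightarrow> g = h)"

definition full_subcategory ::
  "('o, 'a, 'm) category_scheme \<Rightarrow> 'o set \<Rightarrow> ('o, 'a) category" where
  "full_subcategory C S =
     \<lparr>Obj = Obj C \<inter> S,
      Arr = {f \<in> Arr C. Dom C f \<in> S \<and> Cod C f \<in> S},
      Dom = Dom C, Cod = Cod C, Id = Id C, Comp = Comp C\<rparr>"


section \<open>Tensor categories\<close>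

text \<open>The tensor product is written \<open>\<otimes>\<close> on objects and \<open>\<boxtimes>\<close> on arrows.  The left unit
  constraint is written \<open>\<l>\<close>, since \<open>\<lambda>\<close> is reserved.\<close>

record ('o, 'a) tensor_category = "('o, 'a) category" +
  tensor_obj :: "'o \<Rightarrow> 'o \<Rightarrow> 'o"  (infixr "\<otimes>\<index>" 70)
  tensor_arr :: "'a \<Rightarrow> 'a \<Rightarrow> 'a"  (infixr "\<boxtimes>\<index>" 70)
  unit_obj :: 'o  ("\<one>\<index>")
  associator :: "'o \<Rightarrow> 'o \<Rightarrow> 'o \<Rightarrow> 'a"  ("\<alpha>\<index>")
  left_unitor :: "'o \<Rightarrow> 'a"  ("\<l>\<index>")
  right_unitor :: "'o \<Rightarrow> 'a"  ("\<rho>\<index>")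

locale tensor_category = category C
  for C :: "('o, 'a, 'm) tensor_category_scheme" (structure) +
  assumes tensor_closed: "\<lbrakk>U \<in> Obj C; V \<in> Obj C\<rbrakk> \<Longrightarrow> U \<otimes> V \<in> Obj C"
    and tensor_hom: "\<lbrakk>f \<in> Hom C U U'; g \<in> Hom C V V'\<rbrakk>
      \<Longrightarrow> f \<boxtimes> g \<in> Hom C (U \<otimes> V) (U' \<otimes> V')"
    and tensor_id: "\<lbrakk>U \<in> Obj C; V \<in> Obj C\<rbrakk> \<Longrightarrow> \<i>\<d> U \<boxtimes> \<i>\<d> V = \<i>\<d> (U \<otimes> V)"
    and tensor_comp: "\<lbrakk>f \<in> Hom C U U'; f' \<in> Hom C U' U''; g \<in> Hom C V V'; g' \<in> Hom C V' V''\<rbrakk>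
      \<Longrightarrow> (f' \<cdot> f) \<boxtimes> (g' \<cdot> g) = (f' \<boxtimes> g') \<cdot> (f \<boxtimes> g)"
    and unit_closed: "\<one> \<in> Obj C"
    and assoc_hom: "\<lbrakk>U \<in> Obj C; V \<in> Obj C; W \<in> Obj C\<rbrakk>
      \<Longrightarrow> \<alpha> U V W \<in> Hom C (U \<otimes> (V \<otimes> W)) ((U \<otimes> V) \<otimes> W)"
    and assoc_iso: "\<lbrakk>U \<in> Obj C; V \<in> Obj C; W \<in> Obj C\<rbrakk> \<Longrightarrow> iso_arrow C (\<alpha> U V W)"
    and assoc_natural: "\<lbrakk>f \<in> Hom C U U'; g \<in> Hom C V V'; h \<in> Hom C W W'\<rbrakk>
      \<Longrightarrow> \<alpha> U' V' W' \<cdot> (f \<boxtimes> (g \<boxtimes> h)) = ((f \<boxtimes> g) \<boxtimes> h) \<cdot> \<alpha> U V W"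
    and lunit_hom: "U \<in> Obj C \<Longrightarrow> \<l> U \<in> Hom C (\<one> \<otimes> U) U"
    and lunit_iso: "U \<in> Obj C \<Longrightarrow> iso_arrow C (\<l> U)"
    and lunit_natural: "f \<in> Hom C U V \<Longrightarrow> \<l> V \<cdot> (\<i>\<d> \<one> \<boxtimes> f) = f \<cdot> \<l> U"
    and runit_hom: "U \<in> Obj C \<Longrightarrow> \<rho> U \<in> Hom C (U \<otimes> \<one>) U"
    and runit_iso: "U \<in> Obj C \<Longrightarrow> iso_arrow C (\<rho> U)"
    and runit_natural: "f \<in> Hom C U V \<Longrightarrow> \<rho> V \<cdot> (f \<boxtimes> \<i>\<d> \<one>) = f \<cdot> \<rho> U"
    and pentagon: "\<lbrakk>U \<in> Obj C; V \<in> Obj C; W \<in> Obj C; X \<in> Obj C\<rbrakk>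
      \<Longrightarrow> (\<alpha> U V W \<boxtimes> \<i>\<d> X) \<cdot> \<alpha> U (V \<otimes> W) X \<cdot> (\<i>\<d> U \<boxtimes> \<alpha> V W X)
        = \<alpha> (U \<otimes> V) W X \<cdot> \<alpha> U V (W \<otimes> X)"
    and triangle: "\<lbrakk>U \<in> Obj C; V \<in> Obj C\<rbrakk>
      \<Longrightarrow> (\<rho> U \<boxtimes> \<i>\<d> V) \<cdot> \<alpha> U \<one> V = \<i>\<d> U \<boxtimes> \<l> V"

definition right_dual ::
  "('o, 'a, 'm) tensor_category_scheme \<Rightarrow> 'o \<Rightarrow> 'o \<Rightarrow> 'a \<Rightarrow> 'a \<Rightarrow> bool" where
  "right_dual C U R b d \<longleftrightarrow>
     U \<in> Obj C \<and> R \<in> Obj C \<and>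
     b \<in> Hom C \<one>\<^bsub>C\<^esub> (U \<otimes>\<^bsub>C\<^esub> R) \<and> d \<in> Hom C (R \<otimes>\<^bsub>C\<^esub> U) \<one>\<^bsub>C\<^esub> \<and>
     \<rho>\<^bsub>C\<^esub> U \<cdot>\<^bsub>C\<^esub> (\<i>\<d>\<^bsub>C\<^esub> U \<boxtimes>\<^bsub>C\<^esub> d) \<cdot>\<^bsub>C\<^esub> inv\<^bsub>C\<^esub> (\<alpha>\<^bsub>C\<^esub> U R U)
       \<cdot>\<^bsub>C\<^esub> (b \<boxtimes>\<^bsub>C\<^esub> \<i>\<d>\<^bsub>C\<^esub> U) \<cdot>\<^bsub>C\<^esub> inv\<^bsub>C\<^esub> (\<l>\<^bsub>C\<^esub> U) = \<i>\<d>\<^bsub>C\<^esub> U \<and>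
     \<l>\<^bsub>C\<^esub> R \<cdot>\<^bsub>C\<^esub> (d \<boxtimes>\<^bsub>C\<^esub> \<i>\<d>\<^bsub>C\<^esub> R) \<cdot>\<^bsub>C\<^esub> \<alpha>\<^bsub>C\<^esub> R U R
       \<cdot>\<^bsub>C\<^esub> (\<i>\<d>\<^bsub>C\<^esub> R \<boxtimes>\<^bsub>C\<^esub> b) \<cdot>\<^bsub>C\<^esub> inv\<^bsub>C\<^esub> (\<rho>\<^bsub>C\<^esub> R) = \<i>\<d>\<^bsub>C\<^esub> R"

definition left_dual ::
  "('o, 'a, 'm) tensor_category_scheme \<Rightarrow> 'o \<Rightarrow> 'o \<Rightarrow> 'a \<Rightarrow> 'a \<Rightarrow> bool" where
  "left_dual C U L b d \<longleftrightarrow>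
     U \<in> Obj C \<and> L \<in> Obj C \<and>
     b \<in> Hom C \<one>\<^bsub>C\<^esub> (L \<otimes>\<^bsub>C\<^esub> U) \<and> d \<in> Hom C (U \<otimes>\<^bsub>C\<^esub> L) \<one>\<^bsub>C\<^esub> \<and>
     \<l>\<^bsub>C\<^esub> U \<cdot>\<^bsub>C\<^esub> (d \<boxtimes>\<^bsub>C\<^esub> \<i>\<d>\<^bsub>C\<^esub> U) \<cdot>\<^bsub>C\<^esub> \<alpha>\<^bsub>C\<^esub> U L U
       \<cdot>\<^bsub>C\<^esub> (\<i>\<d>\<^bsub>C\<^esub> U \<boxtimes>\<^bsub>C\<^esub> b) \<cdot>\<^bsub>C\<^esub> inv\<^bsub>C\<^esub> (\<rho>\<^bsub>C\<^esub> U) = \<i>\<d>\<^bsub>C\<^esub> U \<and>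
     \<rho>\<^bsub>C\<^esub> L \<cdot>\<^bsub>C\<^esub> (\<i>\<d>\<^bsub>C\<^esub> L \<boxtimes>\<^bsub>C\<^esub> d) \<cdot>\<^bsub>C\<^esub> inv\<^bsub>C\<^esub> (\<alpha>\<^bsub>C\<^esub> L U L)
       \<cdot>\<^bsub>C\<^esub> (b \<boxtimes>\<^bsub>C\<^esub> \<i>\<d>\<^bsub>C\<^esub> L) \<cdot>\<^bsub>C\<^esub> inv\<^bsub>C\<^esub> (\<l>\<^bsub>C\<^esub> L) = \<i>\<d>\<^bsub>C\<^esub> L"


section \<open>Condition C\<close>

text \<open>The contravariant functor \<open>(-)\<^sup>*\<close> is written \<open>U\<^sup>\<star>\<close> on objects and \<open>f\<^sup>\<dagger>\<close> on arrows.\<close>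

record ('o, 'a) star_category = "('o, 'a) tensor_category" +
  star_obj :: "'o \<Rightarrow> 'o"  ("_\<^sup>\<star>\<index>" [1000] 999)
  star_arr :: "'a \<Rightarrow> 'a"  ("_\<^sup>\<dagger>\<index>" [1000] 999)
  star_delta :: "'o \<Rightarrow> 'a"  ("\<delta>\<index>")
  star_pi :: "'o \<Rightarrow> 'o \<Rightarrow> 'a \<Rightarrow> 'a"  ("\<pi>\<index>")

text \<open>Both \<open>Hom(U, V\<^sup>\<star>)\<close> and \<open>Hom(U \<otimes> V, \<one>\<^sup>\<star>)\<close> are contravariant in \<open>U\<close> and in \<open>V\<close>:
  \<open>f : U' \<rightarrow> U\<close> and \<open>g : V' \<rightarrow> V\<close> send \<open>h : U \<rightarrow> V\<^sup>\<star>\<close> to \<open>g\<^sup>\<dagger> \<cdot> h \<cdot> f\<close>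
  and \<open>k : U \<otimes> V \<rightarrow> \<one>\<^sup>\<star>\<close> to \<open>k \<cdot> (f \<boxtimes> g)\<close>.\<close>

locale condition_C = tensor_category C
  for C :: "('o, 'a, 'm) star_category_scheme" (structure) +
  assumes star_closed: "U \<in> Obj C \<Longrightarrow> U\<^sup>\<star> \<in> Obj C"
    and star_hom: "f \<in> Hom C U V \<Longrightarrow> f\<^sup>\<dagger> \<in> Hom C (V\<^sup>\<star>) (U\<^sup>\<star>)"
    and star_id: "U \<in> Obj C \<Longrightarrow> (\<i>\<d> U)\<^sup>\<dagger> = \<i>\<d> (U\<^sup>\<star>)"
    and star_comp: "\<lbrakk>f \<in> Hom C U V; g \<in> Hom C V W\<rbrakk> \<Longrightarrow> (g \<cdot> f)\<^sup>\<dagger> = f\<^sup>\<dagger> \<cdot> g\<^sup>\<dagger>"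
    and delta_hom: "U \<in> Obj C \<Longrightarrow> \<delta> U \<in> Hom C U ((U\<^sup>\<star>)\<^sup>\<star>)"
    and delta_iso: "U \<in> Obj C \<Longrightarrow> iso_arrow C (\<delta> U)"
    and delta_natural: "f \<in> Hom C U V \<Longrightarrow> \<delta> V \<cdot> f = (f\<^sup>\<dagger>)\<^sup>\<dagger> \<cdot> \<delta> U"
    and pi_bij: "\<lbrakk>U \<in> Obj C; V \<in> Obj C\<rbrakk>
      \<Longrightarrow> bij_betw (\<pi> U V) (Hom C U (V\<^sup>\<star>)) (Hom C (U \<otimes> V) (\<one>\<^sup>\<star>))"
    and pi_natural: "\<lbrakk>f \<in> Hom C U' U; g \<in> Hom C V' V; h \<in> Hom C U (V\<^sup>\<star>)\<rbrakk>
      \<Longrightarrow> \<pi> U' V' (g\<^sup>\<dagger> \<cdot> h \<cdot> f) = \<pi> U V h \<cdot> (f \<boxtimes> g)"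

definition Cb :: "('o, 'a, 'm) star_category_scheme \<Rightarrow> ('o, 'a) category" where
  "Cb C = full_subcategory C {U \<in> Obj C.
     (\<exists>b d. right_dual C U (U\<^sup>\<star>\<^bsub>C\<^esub>) b d \<and> monomorphism C b) \<and>
     (\<exists>b d. left_dual C U (U\<^sup>\<star>\<^bsub>C\<^esub>) b d \<and> monomorphism C b)}"

end

theory Submission
  imports Defs
begin

text \<open>If \<open>A\<^sup>\<star>\<close> is a right dual of \<open>A\<close>, then \<open>- \<otimes> A\<close> is left adjoint to \<open>- \<otimes> A\<^sup>\<star>\<close>, so
  \<open>Hom(U, B \<otimes> A\<^sup>\<star>) = Hom(U \<otimes> A, B) = Hom(U \<otimes> A, B\<^sup>\<star>\<^sup>\<star>) = Hom((U \<otimes> A) \<otimes> B\<^sup>\<star>, \<one>\<^sup>\<star>)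
  = Hom(U \<otimes> (A \<otimes> B\<^sup>\<star>), \<one>\<^sup>\<star>) = Hom(U, (A \<otimes> B\<^sup>\<star>)\<^sup>\<star>)\<close>, naturally in \<open>U\<close>; the Yoneda lemma
  gives the isomorphism.\<close>

section \<open>Categories\<close>

context category
begin

lemma HomD:
  assumes "f \<in> Hom C U V"
  shows "f \<in> Arr C" "Dom C f = U" "Cod C f = V"
  using assms by (auto simp: Hom_def)

lemma HomI: "\<lbrakk>f \<in> Arr C; Dom C f = U; Cod C f = V\<rbrakk> \<Longrightarrow> f \<in> Hom C U V"
  by (auto simp: Hom_def)

lemma Hom_obj:
  assumes "f \<in> Hom C U V"
  shows "U \<in> Obj C" "V \<in> Obj C"
  using assms dom_obj cod_obj by (auto simp: Hom_def)

text \<open>The rules here and the \<open>_arr\<close> variants below express typing through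
  \<open>Arr\<close>, \<open>Dom\<close> and \<open>Cod\<close> rather than \<open>Hom\<close>, so
  that simplification can settle side conditions of long composites without guessing source and
  target.\<close>

lemma id_simps [simp]:
  assumes "U \<in> Obj C"
  shows "\<i>\<d> U \<in> Arr C" "Dom C (\<i>\<d> U) = U" "Cod C (\<i>\<d> U) = U"
  using HomD[OF id_hom[OF assms]] by auto

lemma comp_simps [simp]:
  assumes "f \<in> Arr C" "g \<in> Arr C" "Cod C f = Dom C g"
  shows "g \<cdot> f \<in> Arr C" "Dom C (g \<cdot> f) = Dom C f" "Cod C (g \<cdot> f) = Cod C g"
  using comp_hom[OF HomI[of f] HomI[of g]] assms by (auto simp: Hom_def)

lemma comp_id_arr [simp]: "\<lbrakk>f \<in> Arr C; Dom C f = U\<rbrakk> \<Longrightarrow> f \<cdot> \<i>\<d> U = f"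
  using id_right HomI by blast

lemma id_comp_arr [simp]: "\<lbrakk>f \<in> Arr C; Cod C f = V\<rbrakk> \<Longrightarrow> \<i>\<d> V \<cdot> f = f"
  using id_left HomI by blast

lemma comp_assoc_arr:
  assumes "f \<in> Arr C" "g \<in> Arr C" "h \<in> Arr C" "Cod C f = Dom C g" "Cod C g = Dom C h"
  shows "(h \<cdot> g) \<cdot> f = h \<cdot> (g \<cdot> f)"
  using comp_assoc HomI assms by metis

text \<open>Turns an equation between composites into a rewrite rule that also fires inside a
  composite associated to the right.\<close>

lemma comp_reduce:
  assumes "g \<cdot> f = k" "f \<in> Arr C" "g \<in> Arr C" "Cod C f = Dom C g"
    and "x \<in> Arr C" "Cod C x = Dom C f"
  shows "g \<cdot> (f \<cdot> x) = k \<cdot> x"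
  using assms comp_assoc_arr by metis

lemma inverse_arrows_unique:
  assumes "inverse_arrows C f g" "inverse_arrows C f h"
  shows "g = h"
proof -
  have "g = g \<cdot> (f \<cdot> h)"
    using assms by (auto simp: inverse_arrows_def Hom_def)
  also have "\<dots> = (g \<cdot> f) \<cdot> h"
    using assms by (subst comp_assoc_arr) (auto simp: inverse_arrows_def Hom_def)
  also have "\<dots> = h"
    using assms by (auto simp: inverse_arrows_def Hom_def)
  finally show ?thesis .
qed

text \<open>Uniqueness of inverses gives the definite description behind \<open>inv\<close> its
  meaning.\<close>

lemma inverse_arrows_inv: "iso_arrow C f \<Longrightarrow> inverse_arrows C f (inv f)"
  unfolding iso_arrow_def inverse_arrow_def
  by (metis inverse_arrows_unique theI)

lemma inv_simps:
  assumes "iso_arrow C f" "f \<in> Hom C U V"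
  shows "inv f \<in> Arr C" "Dom C (inv f) = V" "Cod C (inv f) = U"
    "inv f \<cdot> f = \<i>\<d> U" "f \<cdot> inv f = \<i>\<d> V"
  using inverse_arrows_inv[OF assms(1)] HomD[OF assms(2)]
  by (auto simp: inverse_arrows_def Hom_def)

section \<open>Bijections of Hom-sets and the Yoneda lemma\<close>

lemma bij_betw_comp_left:
  assumes "iso_arrow C f" "f \<in> Hom C V W" "U \<in> Obj C"
  shows "bij_betw (\<lambda>h. f \<cdot> h) (Hom C U V) (Hom C U W)"
proof (rule bij_betw_byWitness[where f' = "\<lambda>h. inv f \<cdot> h"])
  note i = inv_simps[OF assms(1,2)] HomD[OF assms(2)]
  show "\<forall>h \<in> Hom C U V. inv f \<cdot> (f \<cdot> h) = h"
    using i by (auto simp: Hom_def comp_reduce[OF i(4)])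
  show "\<forall>h \<in> Hom C U W. f \<cdot> (inv f \<cdot> h) = h"
    using i by (auto simp: Hom_def comp_reduce[OF i(5)])
qed (use inv_simps[OF assms(1,2)] HomD[OF assms(2)] in \<open>auto simp: Hom_def\<close>)

lemma bij_betw_comp_right:
  assumes "iso_arrow C f" "f \<in> Hom C U V" "W \<in> Obj C"
  shows "bij_betw (\<lambda>h. h \<cdot> f) (Hom C V W) (Hom C U W)"
proof (rule bij_betw_byWitness[where f' = "\<lambda>h. h \<cdot> inv f"])
  note i = inv_simps[OF assms(1,2)] HomD[OF assms(2)]
  show "\<forall>h \<in> Hom C V W. (h \<cdot> f) \<cdot> inv f = h"
    using i by (auto simp: Hom_def comp_assoc_arr)
  show "\<forall>h \<in> Hom C U W. (h \<cdot> inv f) \<cdot> f = h"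
    using i by (auto simp: Hom_def comp_assoc_arr)
qed (use inv_simps[OF assms(1,2)] HomD[OF assms(2)] in \<open>auto simp: Hom_def\<close>)

lemma iso_cancel_right:
  assumes "iso_arrow C f" "f \<in> Hom C U V" "g \<in> Hom C V W" "h \<in> Hom C V W" "g \<cdot> f = h \<cdot> f"
  shows "g = h"
  using bij_betw_comp_right[OF assms(1,2) Hom_obj(2)[OF assms(3)]] assms(3-5)
  by (auto simp: bij_betw_def dest: inj_onD)

text \<open>\<open>F\<close> with \<open>act\<close> plays the presheaf that both \<open>X\<close>
  and \<open>Y\<close> represent. Carrying the universal element of each representation over to the
  other one yields two arrows that are mutually inverse.\<close>

lemma yoneda_isomorphic:
  fixes F :: "'o \<Rightarrow> 'b set" and act :: "'a \<Rightarrow> 'b \<Rightarrow> 'b"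
  assumes X: "X \<in> Obj C" and Y: "Y \<in> Obj C"
    and bij_\<phi>: "\<And>U. U \<in> Obj C \<Longrightarrow> bij_betw (\<phi> U) (Hom C U X) (F U)"
    and bij_\<psi>: "\<And>U. U \<in> Obj C \<Longrightarrow> bij_betw (\<psi> U) (Hom C U Y) (F U)"
    and nat_\<phi>: "\<And>U V f h. \<lbrakk>f \<in> Hom C U V; h \<in> Hom C V X\<rbrakk> \<Longrightarrow> \<phi> U (h \<cdot> f) = act f (\<phi> V h)"
    and nat_\<psi>: "\<And>U V f h. \<lbrakk>f \<in> Hom C U V; h \<in> Hom C V Y\<rbrakk> \<Longrightarrow> \<psi> U (h \<cdot> f) = act f (\<psi> V h)"
  shows "X \<cong> Y"
proof -
  have "\<phi> X (\<i>\<d> X) \<in> F X" "\<psi> Y (\<i>\<d> Y) \<in> F Y"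
    using bij_\<phi>[OF X] bij_\<psi>[OF Y] id_hom X Y by (auto dest: bij_betwE)
  \<comment> \<open>The arrow \<open>u\<close> corresponds under \<open>\<psi> X\<close> to the
    universal element of \<open>\<phi>\<close>, and \<open>v\<close> corresponds under
    \<open>\<phi> Y\<close> to that of \<open>\<psi>\<close>.\<close>
  then obtain u v where u: "u \<in> Hom C X Y" "\<psi> X u = \<phi> X (\<i>\<d> X)"
    and v: "v \<in> Hom C Y X" "\<phi> Y v = \<psi> Y (\<i>\<d> Y)"
    using bij_\<psi>[OF X] bij_\<phi>[OF Y] unfolding bij_betw_def by (metis imageE)
  \<comment> \<open>Naturality on both sides: \<open>\<phi> X (v \<cdot> u) = act u (\<phi> Y v) =
    act u (\<psi> Y (\<i>\<d> Y)) = \<psi> X u\<close>. Injectivity of \<open>\<phi> X\<close> then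
    removes \<open>\<phi> X\<close>.\<close>
  have "\<phi> X (v \<cdot> u) = \<phi> X (\<i>\<d> X)"
    using nat_\<phi>[OF u(1) v(1)] nat_\<psi>[OF u(1) id_hom[OF Y]] u v id_left by simp
  then have vu: "v \<cdot> u = \<i>\<d> X"
    using bij_\<phi>[OF X] comp_hom[OF u(1) v(1)] id_hom[OF X]
    by (auto simp: bij_betw_def dest: inj_onD)
  have "\<psi> Y (u \<cdot> v) = \<psi> Y (\<i>\<d> Y)"
    using nat_\<psi>[OF v(1) u(1)] nat_\<phi>[OF v(1) id_hom[OF X]] u v id_left by simp
  then have "u \<cdot> v = \<i>\<d> Y"
    using bij_\<psi>[OF Y] comp_hom[OF v(1) u(1)] id_hom[OF Y]
    by (auto simp: bij_betw_def dest: inj_onD)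
  with vu u(1) v(1) show ?thesis
    unfolding isomorphic_def iso_arrow_def inverse_arrows_def by (auto simp: Hom_def)
qed

end

section \<open>Tensor categories\<close>

context tensor_category
begin

lemmas obj_closed [simp] = tensor_closed unit_closed

lemma tensor_simps [simp]:
  assumes "f \<in> Arr C" "g \<in> Arr C"
  shows "f \<boxtimes> g \<in> Arr C" "Dom C (f \<boxtimes> g) = Dom C f \<otimes> Dom C g"
    "Cod C (f \<boxtimes> g) = Cod C f \<otimes> Cod C g"
  using tensor_hom[OF HomI[of f] HomI[of g]] assms by (auto simp: Hom_def)

text \<open>Oriented to fuse a composite of tensor products into a single tensor product, which is
  how later calculations collect everything behind a common identity factor.\<close>

lemma interchange:
  assumes "f \<in> Arr C" "f' \<in> Arr C" "g \<in> Arr C" "g' \<in> Arr C"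
    and "Cod C f = Dom C f'" "Cod C g = Dom C g'"
  shows "(f' \<boxtimes> g') \<cdot> (f \<boxtimes> g) = (f' \<cdot> f) \<boxtimes> (g' \<cdot> g)"
  using tensor_comp HomI assms by metis

lemma assoc_simps [simp]:
  assumes "U \<in> Obj C" "V \<in> Obj C" "W \<in> Obj C"
  shows "\<alpha> U V W \<in> Arr C" "Dom C (\<alpha> U V W) = U \<otimes> (V \<otimes> W)" "Cod C (\<alpha> U V W) = (U \<otimes> V) \<otimes> W"
    "inv (\<alpha> U V W) \<in> Arr C" "Dom C (inv (\<alpha> U V W)) = (U \<otimes> V) \<otimes> W"
    "Cod C (inv (\<alpha> U V W)) = U \<otimes> (V \<otimes> W)"
    "inv (\<alpha> U V W) \<cdot> \<alpha> U V W = \<i>\<d> (U \<otimes> (V \<otimes> W))"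
    "\<alpha> U V W \<cdot> inv (\<alpha> U V W) = \<i>\<d> ((U \<otimes> V) \<otimes> W)"
  using HomD[OF assoc_hom[OF assms]] inv_simps[OF assoc_iso assoc_hom, OF assms assms] by auto

lemma lunit_simps [simp]:
  assumes "U \<in> Obj C"
  shows "\<l> U \<in> Arr C" "Dom C (\<l> U) = \<one> \<otimes> U" "Cod C (\<l> U) = U"
    "inv (\<l> U) \<in> Arr C" "Dom C (inv (\<l> U)) = U" "Cod C (inv (\<l> U)) = \<one> \<otimes> U"
    "inv (\<l> U) \<cdot> \<l> U = \<i>\<d> (\<one> \<otimes> U)" "\<l> U \<cdot> inv (\<l> U) = \<i>\<d> U"
  using HomD[OF lunit_hom[OF assms]] inv_simps[OF lunit_iso lunit_hom, OF assms assms] by auto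

lemma runit_simps [simp]:
  assumes "U \<in> Obj C"
  shows "\<rho> U \<in> Arr C" "Dom C (\<rho> U) = U \<otimes> \<one>" "Cod C (\<rho> U) = U"
    "inv (\<rho> U) \<in> Arr C" "Dom C (inv (\<rho> U)) = U" "Cod C (inv (\<rho> U)) = U \<otimes> \<one>"
    "inv (\<rho> U) \<cdot> \<rho> U = \<i>\<d> (U \<otimes> \<one>)" "\<rho> U \<cdot> inv (\<rho> U) = \<i>\<d> U"
  using HomD[OF runit_hom[OF assms]] inv_simps[OF runit_iso runit_hom, OF assms assms] by auto

section \<open>Naturality of inverse constraints and coherence of the right unit\<close>

lemma inv_assoc_natural:
  assumes f: "f \<in> Hom C U U'" and g: "g \<in> Hom C V V'" and h: "h \<in> Hom C W W'"
  shows "inv (\<alpha> U' V' W') \<cdot> ((f \<boxtimes> g) \<boxtimes> h) = (f \<boxtimes> (g \<boxtimes> h)) \<cdot> inv (\<alpha> U V W)"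
proof -
  note o [simp] = Hom_obj[OF f] Hom_obj[OF g] Hom_obj[OF h] HomD[OF f] HomD[OF g] HomD[OF h]
  note cancel = comp_reduce[OF assoc_simps(7)] comp_reduce[OF assoc_simps(8)]
  have "inv (\<alpha> U' V' W') \<cdot> ((f \<boxtimes> g) \<boxtimes> h)
      = inv (\<alpha> U' V' W') \<cdot> (((f \<boxtimes> g) \<boxtimes> h) \<cdot> \<alpha> U V W) \<cdot> inv (\<alpha> U V W)"
    by (simp add: comp_assoc_arr)
  also have "\<dots> = inv (\<alpha> U' V' W') \<cdot> (\<alpha> U' V' W' \<cdot> (f \<boxtimes> (g \<boxtimes> h))) \<cdot> inv (\<alpha> U V W)"
    using assoc_natural[OF f g h] by simp
  also have "\<dots> = (f \<boxtimes> (g \<boxtimes> h)) \<cdot> inv (\<alpha> U V W)"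
    by (simp add: comp_assoc_arr cancel)
  finally show ?thesis .
qed

lemma inv_runit_natural:
  assumes f: "f \<in> Hom C U V"
  shows "inv (\<rho> V) \<cdot> f = (f \<boxtimes> \<i>\<d> \<one>) \<cdot> inv (\<rho> U)"
proof -
  note o [simp] = Hom_obj[OF f] HomD[OF f]
  have "inv (\<rho> V) \<cdot> f = inv (\<rho> V) \<cdot> (f \<cdot> \<rho> U) \<cdot> inv (\<rho> U)"
    by (simp add: comp_assoc_arr)
  also have "\<dots> = inv (\<rho> V) \<cdot> (\<rho> V \<cdot> (f \<boxtimes> \<i>\<d> \<one>)) \<cdot> inv (\<rho> U)"
    using runit_natural[OF f] by simp
  also have "\<dots> = (f \<boxtimes> \<i>\<d> \<one>) \<cdot> inv (\<rho> U)"
    by (simp add: comp_assoc_arr comp_reduce[OF runit_simps(7)])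
  finally show ?thesis .
qed

text \<open>By naturality of \<open>\<rho>\<close>, the tensored arrow determines
  \<open>f \<cdot> \<rho> U\<close>, and \<open>\<rho> U\<close> is invertible.\<close>

lemma tensor_unit_faithful:
  assumes f: "f \<in> Hom C U V" and g: "g \<in> Hom C U V" and eq: "f \<boxtimes> \<i>\<d> \<one> = g \<boxtimes> \<i>\<d> \<one>"
  shows "f = g"
proof (rule iso_cancel_right[OF runit_iso runit_hom f g])
  show "f \<cdot> \<rho> U = g \<cdot> \<rho> U"
    using runit_natural[OF f] runit_natural[OF g] eq by simp
qed (use Hom_obj[OF f] in auto)

lemma iso_arrow_tensor_id:
  assumes "U \<in> Obj C" "iso_arrow C f" "f \<in> Hom C V W"
  shows "iso_arrow C (\<i>\<d> U \<boxtimes> f)"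
proof -
  have "inverse_arrows C (\<i>\<d> U \<boxtimes> f) (\<i>\<d> U \<boxtimes> inv f)"
    using inv_simps[OF assms(2,3)] HomD[OF assms(3)] Hom_obj[OF assms(3)] assms(1)
    by (auto simp: inverse_arrows_def Hom_def interchange tensor_id)
  then show ?thesis by (auto simp: iso_arrow_def)
qed

text \<open>Kelly: this coherence follows from the pentagon and the triangle.  It suffices to check
  it after tensoring with the unit, where the pentagon for \<open>U, V, \<one>, \<one>\<close> applies.\<close>

lemma runit_tensor:
  assumes [simp]: "U \<in> Obj C" "V \<in> Obj C"
  shows "\<rho> (U \<otimes> V) \<cdot> \<alpha> U V \<one> = \<i>\<d> U \<boxtimes> \<rho> V"
proof (rule tensor_unit_faithful)
  let ?L = "\<rho> (U \<otimes> V) \<cdot> \<alpha> U V \<one>" and ?R = "\<i>\<d> U \<boxtimes> \<rho> V"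
  show L: "?L \<in> Hom C (U \<otimes> V \<otimes> \<one>) (U \<otimes> V)" and R: "?R \<in> Hom C (U \<otimes> V \<otimes> \<one>) (U \<otimes> V)"
    by (auto intro: HomI)
  \<comment> \<open>Precomposing with these two invertible arrows completes the left side to the
    long side of the pentagon for \<open>U\<close>, \<open>V\<close>, \<open>\<one>\<close>,
    \<open>\<one>\<close>.\<close>
  have "(?L \<boxtimes> \<i>\<d> \<one>) \<cdot> \<alpha> U (V \<otimes> \<one>) \<one> \<cdot> (\<i>\<d> U \<boxtimes> \<alpha> V \<one> \<one>)
      = (\<rho> (U \<otimes> V) \<boxtimes> \<i>\<d> \<one>) \<cdot> ((\<alpha> U V \<one> \<boxtimes> \<i>\<d> \<one>) \<cdot> \<alpha> U (V \<otimes> \<one>) \<one> \<cdot> (\<i>\<d> U \<boxtimes> \<alpha> V \<one> \<one>))"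
    using interchange[of "\<alpha> U V \<one>" "\<rho> (U \<otimes> V)" "\<i>\<d> \<one>" "\<i>\<d> \<one>"]
    by (simp add: comp_assoc_arr[symmetric])
  also have "\<dots> = (\<rho> (U \<otimes> V) \<boxtimes> \<i>\<d> \<one>) \<cdot> (\<alpha> (U \<otimes> V) \<one> \<one> \<cdot> \<alpha> U V (\<one> \<otimes> \<one>))"
    by (simp add: pentagon)
  \<comment> \<open>The triangle is applied to the pair \<open>U \<otimes> V\<close>,
    \<open>\<one>\<close> here; two lines of the calculation later it is read backwards for
    \<open>V\<close>, \<open>\<one>\<close>, which brings in \<open>\<rho> V\<close>.\<close>
  also have "\<dots> = (\<i>\<d> (U \<otimes> V) \<boxtimes> \<l> \<one>) \<cdot> \<alpha> U V (\<one> \<otimes> \<one>)"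
    by (simp add: comp_reduce[OF triangle])
  also have "\<dots> = \<alpha> U V \<one> \<cdot> (\<i>\<d> U \<boxtimes> (\<i>\<d> V \<boxtimes> \<l> \<one>))"
    using assoc_natural[of "\<i>\<d> U" U U "\<i>\<d> V" V V "\<l> \<one>" "\<one> \<otimes> \<one>" \<one>]
    by (simp add: id_hom lunit_hom tensor_id)
  also have "\<dots> = \<alpha> U V \<one> \<cdot> (\<i>\<d> U \<boxtimes> (\<rho> V \<boxtimes> \<i>\<d> \<one>)) \<cdot> (\<i>\<d> U \<boxtimes> \<alpha> V \<one> \<one>)"
    by (simp add: interchange triangle)
  also have "\<dots> = (?R \<boxtimes> \<i>\<d> \<one>) \<cdot> \<alpha> U (V \<otimes> \<one>) \<one> \<cdot> (\<i>\<d> U \<boxtimes> \<alpha> V \<one> \<one>)"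
    by (simp add: comp_reduce[OF assoc_natural[OF id_hom runit_hom id_hom]] comp_assoc_arr)
  finally have "((?L \<boxtimes> \<i>\<d> \<one>) \<cdot> \<alpha> U (V \<otimes> \<one>) \<one>) \<cdot> (\<i>\<d> U \<boxtimes> \<alpha> V \<one> \<one>)
      = ((?R \<boxtimes> \<i>\<d> \<one>) \<cdot> \<alpha> U (V \<otimes> \<one>) \<one>) \<cdot> (\<i>\<d> U \<boxtimes> \<alpha> V \<one> \<one>)"
    by (simp add: comp_assoc_arr)
  \<comment> \<open>The two auxiliary isomorphisms are cancelled one after the other.\<close>
  then have "(?L \<boxtimes> \<i>\<d> \<one>) \<cdot> \<alpha> U (V \<otimes> \<one>) \<one> = (?R \<boxtimes> \<i>\<d> \<one>) \<cdot> \<alpha> U (V \<otimes> \<one>) \<one>"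
    by (rule iso_cancel_right[OF iso_arrow_tensor_id[OF _ assoc_iso assoc_hom], rotated -1])
      (auto intro: HomI)
  then show "?L \<boxtimes> \<i>\<d> \<one> = ?R \<boxtimes> \<i>\<d> \<one>"
    by (rule iso_cancel_right[OF assoc_iso assoc_hom, rotated -1]) (auto intro: HomI)
qed

end

section \<open>The adjunction of a dual pair\<close>

locale right_dual_pair = tensor_category C
  for C :: "('o, 'a, 'm) tensor_category_scheme" (structure) +
  fixes A R b d
  assumes dual: "right_dual C A R b d"
begin

lemma dual_simps [simp]:
  "A \<in> Obj C" "R \<in> Obj C"
  "b \<in> Arr C" "Dom C b = \<one>" "Cod C b = A \<otimes> R"
  "d \<in> Arr C" "Dom C d = R \<otimes> A" "Cod C d = \<one>"
  using dual by (auto simp: right_dual_def Hom_def)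

lemma b_hom: "b \<in> Hom C \<one> (A \<otimes> R)" and d_hom: "d \<in> Hom C (R \<otimes> A) \<one>"
  by (auto intro: HomI)

text \<open>Together with \<open>unit\<close>, the data of the adjunction in which
  \<open>- \<otimes> A\<close> is left adjoint to \<open>- \<otimes> R\<close>; this one is the
  component at \<open>V\<close> of the counit.\<close>

definition counit :: "'o \<Rightarrow> 'a" where
  "counit V = \<rho> V \<cdot> (\<i>\<d> V \<boxtimes> d) \<cdot> inv (\<alpha> V R A)"

definition unit :: "'o \<Rightarrow> 'a" where
  "unit U = \<alpha> U A R \<cdot> (\<i>\<d> U \<boxtimes> b) \<cdot> inv (\<rho> U)"

lemma counit_simps [simp]:
  assumes "V \<in> Obj C"
  shows "counit V \<in> Arr C" "Dom C (counit V) = (V \<otimes> R) \<otimes> A" "Cod C (counit V) = V"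
  using assms by (auto simp: counit_def)

lemma unit_simps [simp]:
  assumes "U \<in> Obj C"
  shows "unit U \<in> Arr C" "Dom C (unit U) = U" "Cod C (unit U) = (U \<otimes> A) \<otimes> R"
  using assms by (auto simp: unit_def)

text \<open>The arrow \<open>f\<close> moves to the left past each factor in turn: the inverse
  associator by naturality, \<open>d\<close> by interchange, \<open>\<rho>\<close> by
  naturality.\<close>

lemma counit_natural:
  assumes f: "f \<in> Hom C U V"
  shows "counit V \<cdot> ((f \<boxtimes> \<i>\<d> R) \<boxtimes> \<i>\<d> A) = f \<cdot> counit U"
proof -
  note o [simp] = Hom_obj[OF f] HomD[OF f]
  have "counit V \<cdot> ((f \<boxtimes> \<i>\<d> R) \<boxtimes> \<i>\<d> A)
      = \<rho> V \<cdot> (\<i>\<d> V \<boxtimes> d) \<cdot> (f \<boxtimes> \<i>\<d> (R \<otimes> A)) \<cdot> inv (\<alpha> U R A)"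
    using inv_assoc_natural[OF f id_hom id_hom, of R A]
    by (simp add: counit_def comp_assoc_arr tensor_id)
  also have "\<dots> = \<rho> V \<cdot> (f \<boxtimes> \<i>\<d> \<one>) \<cdot> (\<i>\<d> U \<boxtimes> d) \<cdot> inv (\<alpha> U R A)"
    by (simp add: comp_assoc_arr[symmetric] interchange)
  also have "\<dots> = f \<cdot> counit U"
    using runit_natural[OF f]
    by (simp add: comp_reduce[OF runit_natural[OF f]] counit_def comp_assoc_arr)
  finally show ?thesis .
qed

lemma unit_natural:
  assumes f: "f \<in> Hom C U V"
  shows "unit V \<cdot> f = ((f \<boxtimes> \<i>\<d> A) \<boxtimes> \<i>\<d> R) \<cdot> unit U"
proof -
  note o [simp] = Hom_obj[OF f] HomD[OF f]
  have "unit V \<cdot> f = \<alpha> V A R \<cdot> (\<i>\<d> V \<boxtimes> b) \<cdot> (f \<boxtimes> \<i>\<d> \<one>) \<cdot> inv (\<rho> U)"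
    by (simp add: unit_def comp_assoc_arr inv_runit_natural[OF f])
  also have "\<dots> = \<alpha> V A R \<cdot> (f \<boxtimes> (\<i>\<d> A \<boxtimes> \<i>\<d> R)) \<cdot> (\<i>\<d> U \<boxtimes> b) \<cdot> inv (\<rho> U)"
    by (simp add: comp_assoc_arr[symmetric] interchange tensor_id)
  also have "\<dots> = ((f \<boxtimes> \<i>\<d> A) \<boxtimes> \<i>\<d> R) \<cdot> unit U"
    by (simp add: comp_reduce[OF assoc_natural[OF f id_hom id_hom]] unit_def comp_assoc_arr)
  finally show ?thesis .
qed

text \<open>A triangle identity of the adjunction. The coherence laws bring the composite into the
  form \<open>\<i>\<d> U\<close> tensored with the first zig-zag of the dual pair.\<close>

lemma counit_unit:
  assumes [simp]: "U \<in> Obj C"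
  shows "counit (U \<otimes> A) \<cdot> (unit U \<boxtimes> \<i>\<d> A) = \<i>\<d> (U \<otimes> A)"
proof -
  \<comment> \<open>The pentagon for \<open>U\<close>, \<open>A\<close>, \<open>R\<close>,
    \<open>A\<close>, with three of its associators moved to the other side as inverses.\<close>
  have pent: "inv (\<alpha> (U \<otimes> A) R A) \<cdot> (\<alpha> U A R \<boxtimes> \<i>\<d> A)
      = \<alpha> U A (R \<otimes> A) \<cdot> (\<i>\<d> U \<boxtimes> inv (\<alpha> A R A)) \<cdot> inv (\<alpha> U (A \<otimes> R) A)"
  proof -
    have cancel: "(\<i>\<d> U \<boxtimes> \<alpha> A R A) \<cdot> (\<i>\<d> U \<boxtimes> inv (\<alpha> A R A)) = \<i>\<d> (U \<otimes> (A \<otimes> R) \<otimes> A)"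
      by (simp add: interchange tensor_id)
    have "\<alpha> U A (R \<otimes> A) \<cdot> (\<i>\<d> U \<boxtimes> inv (\<alpha> A R A)) \<cdot> inv (\<alpha> U (A \<otimes> R) A)
        = inv (\<alpha> (U \<otimes> A) R A) \<cdot> (\<alpha> (U \<otimes> A) R A \<cdot> \<alpha> U A (R \<otimes> A))
          \<cdot> (\<i>\<d> U \<boxtimes> inv (\<alpha> A R A)) \<cdot> inv (\<alpha> U (A \<otimes> R) A)"
      by (simp add: comp_assoc_arr comp_reduce[OF assoc_simps(7)])
    also have "\<dots> = inv (\<alpha> (U \<otimes> A) R A) \<cdot> (\<alpha> U A R \<boxtimes> \<i>\<d> A)"
      unfolding pentagon[OF assms dual_simps(1,2,1), symmetric]
      by (simp add: comp_assoc_arr comp_reduce[OF cancel])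
    finally show ?thesis ..
  qed
  \<comment> \<open>The triangle law with both sides inverted.\<close>
  have tri: "inv (\<alpha> U \<one> A) \<cdot> (inv (\<rho> U) \<boxtimes> \<i>\<d> A) = \<i>\<d> U \<boxtimes> inv (\<l> A)"
  proof -
    have "inv (\<alpha> U \<one> A) \<cdot> (inv (\<rho> U) \<boxtimes> \<i>\<d> A)
        = inv (\<alpha> U \<one> A) \<cdot> (inv (\<rho> U) \<boxtimes> \<i>\<d> A) \<cdot> (\<i>\<d> U \<boxtimes> \<l> A) \<cdot> (\<i>\<d> U \<boxtimes> inv (\<l> A))"
      by (simp add: interchange tensor_id)
    also have "\<dots> = inv (\<alpha> U \<one> A) \<cdot> (((inv (\<rho> U) \<boxtimes> \<i>\<d> A) \<cdot> (\<rho> U \<boxtimes> \<i>\<d> A)) \<cdot> \<alpha> U \<one> A)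
        \<cdot> (\<i>\<d> U \<boxtimes> inv (\<l> A))"
      unfolding triangle[OF assms dual_simps(1), symmetric] by (simp add: comp_assoc_arr)
    also have "\<dots> = \<i>\<d> U \<boxtimes> inv (\<l> A)"
      by (simp add: interchange tensor_id comp_reduce[OF assoc_simps(7)])
    finally show ?thesis .
  qed
  have nat_b: "inv (\<alpha> U (A \<otimes> R) A) \<cdot> ((\<i>\<d> U \<boxtimes> b) \<boxtimes> \<i>\<d> A) = (\<i>\<d> U \<boxtimes> (b \<boxtimes> \<i>\<d> A)) \<cdot> inv (\<alpha> U \<one> A)"
    by (simp add: inv_assoc_natural[OF id_hom b_hom id_hom])
  have nat_d: "(\<i>\<d> (U \<otimes> A) \<boxtimes> d) \<cdot> \<alpha> U A (R \<otimes> A) = \<alpha> U A \<one> \<cdot> (\<i>\<d> U \<boxtimes> (\<i>\<d> A \<boxtimes> d))"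
    using assoc_natural[OF id_hom id_hom d_hom, of U A] by (simp add: tensor_id)
  have unit_split: "unit U \<boxtimes> \<i>\<d> A
      = (\<alpha> U A R \<boxtimes> \<i>\<d> A) \<cdot> ((\<i>\<d> U \<boxtimes> b) \<boxtimes> \<i>\<d> A) \<cdot> (inv (\<rho> U) \<boxtimes> \<i>\<d> A)"
    by (simp add: unit_def interchange)
  have "counit (U \<otimes> A) \<cdot> (unit U \<boxtimes> \<i>\<d> A)
      = \<rho> (U \<otimes> A) \<cdot> (\<i>\<d> (U \<otimes> A) \<boxtimes> d) \<cdot> \<alpha> U A (R \<otimes> A) \<cdot> (\<i>\<d> U \<boxtimes> inv (\<alpha> A R A))
        \<cdot> (\<i>\<d> U \<boxtimes> (b \<boxtimes> \<i>\<d> A)) \<cdot> (\<i>\<d> U \<boxtimes> inv (\<l> A))"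
    unfolding unit_split counit_def
    by (simp add: comp_assoc_arr comp_reduce[OF pent] comp_reduce[OF nat_b] tri)
  \<comment> \<open>Naturality carries \<open>d\<close> past the associator, which then meets
    \<open>\<rho> (U \<otimes> A)\<close> and is absorbed by \<open>runit_tensor\<close>. Every
    factor now has \<open>\<i>\<d> U\<close> on the left.\<close>
  also have "\<dots> = (\<i>\<d> U \<boxtimes> \<rho> A) \<cdot> (\<i>\<d> U \<boxtimes> (\<i>\<d> A \<boxtimes> d)) \<cdot> (\<i>\<d> U \<boxtimes> inv (\<alpha> A R A))
        \<cdot> (\<i>\<d> U \<boxtimes> (b \<boxtimes> \<i>\<d> A)) \<cdot> (\<i>\<d> U \<boxtimes> inv (\<l> A))"
    by (simp add: comp_assoc_arr comp_reduce[OF nat_d] comp_reduce[OF runit_tensor])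
  also have "\<dots> = \<i>\<d> U \<boxtimes> (\<rho> A \<cdot> (\<i>\<d> A \<boxtimes> d) \<cdot> inv (\<alpha> A R A) \<cdot> (b \<boxtimes> \<i>\<d> A) \<cdot> inv (\<l> A))"
    by (simp add: interchange)
  also have "\<dots> = \<i>\<d> (U \<otimes> A)"
    using dual by (simp add: right_dual_def tensor_id)
  finally show ?thesis .
qed

text \<open>The other triangle identity, reduced in the same way to \<open>\<i>\<d> V\<close>
  tensored with the second zig-zag.\<close>

lemma unit_counit:
  assumes [simp]: "V \<in> Obj C"
  shows "(counit V \<boxtimes> \<i>\<d> R) \<cdot> unit (V \<otimes> R) = \<i>\<d> (V \<otimes> R)"
proof -
  \<comment> \<open>This is \<open>runit_tensor\<close> solved for the inverse of
    \<open>\<rho> (V \<otimes> R)\<close>, the factor that \<open>unit (V \<otimes> R)\<close>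
    contributes.\<close>
  have inv_runit: "inv (\<rho> (V \<otimes> R)) = \<alpha> V R \<one> \<cdot> (\<i>\<d> V \<boxtimes> inv (\<rho> R))"
  proof -
    have "inv (\<rho> (V \<otimes> R)) = inv (\<rho> (V \<otimes> R)) \<cdot> (\<i>\<d> V \<boxtimes> \<rho> R) \<cdot> (\<i>\<d> V \<boxtimes> inv (\<rho> R))"
      by (simp add: interchange tensor_id)
    also have "\<dots> = \<alpha> V R \<one> \<cdot> (\<i>\<d> V \<boxtimes> inv (\<rho> R))"
      unfolding runit_tensor[OF assms dual_simps(2), symmetric]
      by (simp add: comp_assoc_arr comp_reduce[OF runit_simps(7)])
    finally show ?thesis .
  qed
  have nat_b: "(\<i>\<d> (V \<otimes> R) \<boxtimes> b) \<cdot> \<alpha> V R \<one> = \<alpha> V R (A \<otimes> R) \<cdot> (\<i>\<d> V \<boxtimes> (\<i>\<d> R \<boxtimes> b))"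
    using assoc_natural[OF id_hom id_hom b_hom, of V R] by (simp add: tensor_id)
  have nat_d: "((\<i>\<d> V \<boxtimes> d) \<boxtimes> \<i>\<d> R) \<cdot> \<alpha> V (R \<otimes> A) R = \<alpha> V \<one> R \<cdot> (\<i>\<d> V \<boxtimes> (d \<boxtimes> \<i>\<d> R))"
    by (simp add: assoc_natural[OF id_hom d_hom id_hom])
  \<comment> \<open>The pentagon for \<open>V\<close>, \<open>R\<close>, \<open>A\<close>,
    \<open>R\<close>, with \<open>\<alpha> V R A \<boxtimes> \<i>\<d> R\<close> moved to the other
    side.\<close>
  have pent: "(inv (\<alpha> V R A) \<boxtimes> \<i>\<d> R) \<cdot> \<alpha> (V \<otimes> R) A R \<cdot> \<alpha> V R (A \<otimes> R)
      = \<alpha> V (R \<otimes> A) R \<cdot> (\<i>\<d> V \<boxtimes> \<alpha> R A R)"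
  proof -
    have cancel: "(inv (\<alpha> V R A) \<boxtimes> \<i>\<d> R) \<cdot> (\<alpha> V R A \<boxtimes> \<i>\<d> R) = \<i>\<d> ((V \<otimes> R \<otimes> A) \<otimes> R)"
      by (simp add: interchange tensor_id)
    show ?thesis
      unfolding pentagon[OF assms dual_simps(2,1,2), symmetric]
      by (simp add: comp_assoc_arr comp_reduce[OF cancel])
  qed
  have counit_split: "counit V \<boxtimes> \<i>\<d> R
      = (\<rho> V \<boxtimes> \<i>\<d> R) \<cdot> ((\<i>\<d> V \<boxtimes> d) \<boxtimes> \<i>\<d> R) \<cdot> (inv (\<alpha> V R A) \<boxtimes> \<i>\<d> R)"
    by (simp add: counit_def interchange)
  have "(counit V \<boxtimes> \<i>\<d> R) \<cdot> unit (V \<otimes> R)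
      = (\<rho> V \<boxtimes> \<i>\<d> R) \<cdot> ((\<i>\<d> V \<boxtimes> d) \<boxtimes> \<i>\<d> R)
        \<cdot> ((inv (\<alpha> V R A) \<boxtimes> \<i>\<d> R) \<cdot> \<alpha> (V \<otimes> R) A R \<cdot> \<alpha> V R (A \<otimes> R))
        \<cdot> (\<i>\<d> V \<boxtimes> (\<i>\<d> R \<boxtimes> b)) \<cdot> (\<i>\<d> V \<boxtimes> inv (\<rho> R))"
    unfolding counit_split unit_def inv_runit
    by (simp add: comp_assoc_arr comp_reduce[OF nat_b])
  also have "\<dots> = (\<i>\<d> V \<boxtimes> \<l> R) \<cdot> (\<i>\<d> V \<boxtimes> (d \<boxtimes> \<i>\<d> R)) \<cdot> (\<i>\<d> V \<boxtimes> \<alpha> R A R)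
        \<cdot> (\<i>\<d> V \<boxtimes> (\<i>\<d> R \<boxtimes> b)) \<cdot> (\<i>\<d> V \<boxtimes> inv (\<rho> R))"
    unfolding pent by (simp add: comp_assoc_arr comp_reduce[OF nat_d] comp_reduce[OF triangle])
  also have "\<dots> = \<i>\<d> V \<boxtimes> (\<l> R \<cdot> (d \<boxtimes> \<i>\<d> R) \<cdot> \<alpha> R A R \<cdot> (\<i>\<d> R \<boxtimes> b) \<cdot> inv (\<rho> R))"
    by (simp add: interchange)
  also have "\<dots> = \<i>\<d> (V \<otimes> R)"
    using dual by (simp add: right_dual_def tensor_id)
  finally show ?thesis .
qed

text \<open>Transposition across the adjunction. Each round trip is the identity by naturality of
  the unit or counit followed by one triangle identity.\<close>

lemma bij_betw_transpose:
  assumes [simp]: "U \<in> Obj C" "V \<in> Obj C"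
  shows "bij_betw (\<lambda>h. counit V \<cdot> (h \<boxtimes> \<i>\<d> A)) (Hom C U (V \<otimes> R)) (Hom C (U \<otimes> A) V)"
proof (rule bij_betw_byWitness[where f' = "\<lambda>k. (k \<boxtimes> \<i>\<d> R) \<cdot> unit U"])
  show "\<forall>h \<in> Hom C U (V \<otimes> R). ((counit V \<cdot> (h \<boxtimes> \<i>\<d> A)) \<boxtimes> \<i>\<d> R) \<cdot> unit U = h"
  proof
    fix h assume h: "h \<in> Hom C U (V \<otimes> R)"
    note [simp] = HomD[OF h]
    have "(counit V \<cdot> (h \<boxtimes> \<i>\<d> A)) \<boxtimes> \<i>\<d> R = (counit V \<boxtimes> \<i>\<d> R) \<cdot> ((h \<boxtimes> \<i>\<d> A) \<boxtimes> \<i>\<d> R)"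
      by (simp add: interchange)
    then show "((counit V \<cdot> (h \<boxtimes> \<i>\<d> A)) \<boxtimes> \<i>\<d> R) \<cdot> unit U = h"
      by (simp add: comp_assoc_arr unit_natural[OF h, symmetric] comp_reduce[OF unit_counit])
  qed
  show "\<forall>k \<in> Hom C (U \<otimes> A) V. counit V \<cdot> (((k \<boxtimes> \<i>\<d> R) \<cdot> unit U) \<boxtimes> \<i>\<d> A) = k"
  proof
    fix k assume k: "k \<in> Hom C (U \<otimes> A) V"
    note [simp] = HomD[OF k]
    have "((k \<boxtimes> \<i>\<d> R) \<cdot> unit U) \<boxtimes> \<i>\<d> A = ((k \<boxtimes> \<i>\<d> R) \<boxtimes> \<i>\<d> A) \<cdot> (unit U \<boxtimes> \<i>\<d> A)"
      by (simp add: interchange)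
    then show "counit V \<cdot> (((k \<boxtimes> \<i>\<d> R) \<cdot> unit U) \<boxtimes> \<i>\<d> A) = k"
      by (simp add: comp_reduce[OF counit_natural[OF k]] comp_assoc_arr counit_unit)
  qed
qed (auto simp: Hom_def)

end

section \<open>Duals under Condition C\<close>

context condition_C
begin

text \<open>The case \<open>g = \<i>\<d> V\<close> of \<open>pi_natural\<close>; the Yoneda argument
  varies only the first object.\<close>

lemma pi_natural_left:
  assumes "f \<in> Hom C U' U" "h \<in> Hom C U (V\<^sup>\<star>)" "V \<in> Obj C"
  shows "\<pi> U' V (h \<cdot> f) = \<pi> U V h \<cdot> (f \<boxtimes> \<i>\<d> V)"
  using pi_natural[OF assms(1) id_hom[OF assms(3)] assms(2)] HomD[OF assms(1)] HomD[OF assms(2)]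
  by (simp add: star_id assms(3))

lemma pi_hom:
  assumes "U \<in> Obj C" "V \<in> Obj C" "h \<in> Hom C U (V\<^sup>\<star>)"
  shows "\<pi> U V h \<in> Hom C (U \<otimes> V) (\<one>\<^sup>\<star>)"
  using pi_bij[OF assms(1,2)] assms(3) by (auto dest: bij_betwE)

lemma star_tensor_star_isomorphic:
  assumes dual: "right_dual C A R b d" and B [simp]: "B \<in> Obj C"
  shows "(A \<otimes> B\<^sup>\<star>)\<^sup>\<star> \<cong> B \<otimes> R"
proof -
  interpret right_dual_pair C A R b d
    using dual by unfold_locales
  note [simp] = star_closed HomD[OF delta_hom]
  \<comment> \<open>From \<open>h : U \<rightarrow> B \<otimes> R\<close>, the map
    \<open>\<psi> U\<close> forms the transpose \<open>U \<otimes> A \<rightarrow> B\<close>, passes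
    to the double star of \<open>B\<close> by \<open>\<delta>\<close>, applies \<open>\<pi>\<close>,
    and rebrackets with \<open>\<alpha>\<close>.\<close>
  define \<psi> where "\<psi> U h = \<pi> (U \<otimes> A) (B\<^sup>\<star>) (\<delta> B \<cdot> (counit B \<cdot> (h \<boxtimes> \<i>\<d> A))) \<cdot> \<alpha> U A (B\<^sup>\<star>)" for U h
  show ?thesis
  proof (rule yoneda_isomorphic[where \<phi> = "\<lambda>U. \<pi> U (A \<otimes> B\<^sup>\<star>)" and \<psi> = \<psi>
        and F = "\<lambda>U. Hom C (U \<otimes> (A \<otimes> B\<^sup>\<star>)) (\<one>\<^sup>\<star>)" and act = "\<lambda>f k. k \<cdot> (f \<boxtimes> \<i>\<d> (A \<otimes> B\<^sup>\<star>))"])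
    fix U assume [simp]: "U \<in> Obj C"
    show "bij_betw (\<pi> U (A \<otimes> B\<^sup>\<star>)) (Hom C U ((A \<otimes> B\<^sup>\<star>)\<^sup>\<star>)) (Hom C (U \<otimes> (A \<otimes> B\<^sup>\<star>)) (\<one>\<^sup>\<star>))"
      by (simp add: pi_bij)
    have alpha: "bij_betw (\<lambda>h. h \<cdot> \<alpha> U A (B\<^sup>\<star>)) (Hom C ((U \<otimes> A) \<otimes> B\<^sup>\<star>) (\<one>\<^sup>\<star>))
        (Hom C (U \<otimes> (A \<otimes> B\<^sup>\<star>)) (\<one>\<^sup>\<star>))"
      by (simp add: bij_betw_comp_right assoc_iso assoc_hom)
    have pi: "bij_betw (\<pi> (U \<otimes> A) (B\<^sup>\<star>)) (Hom C (U \<otimes> A) ((B\<^sup>\<star>)\<^sup>\<star>))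
        (Hom C ((U \<otimes> A) \<otimes> B\<^sup>\<star>) (\<one>\<^sup>\<star>))"
      by (simp add: pi_bij)
    have delta: "bij_betw (\<lambda>h. \<delta> B \<cdot> h) (Hom C (U \<otimes> A) B) (Hom C (U \<otimes> A) ((B\<^sup>\<star>)\<^sup>\<star>))"
      by (simp add: bij_betw_comp_left delta_iso delta_hom)
    \<comment> \<open>Each of the four stages of \<open>\<psi> U\<close> is a bijection:
      transposition, \<open>\<delta>\<close>, \<open>\<pi>\<close> and
      \<open>\<alpha>\<close>.\<close>
    show "bij_betw (\<psi> U) (Hom C U (B \<otimes> R)) (Hom C (U \<otimes> (A \<otimes> B\<^sup>\<star>)) (\<one>\<^sup>\<star>))"
      using bij_betw_trans[OF bij_betw_trans[OF bij_betw_trans[OF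
            bij_betw_transpose[OF \<open>U \<in> Obj C\<close> B] delta] pi] alpha]
      by (simp add: \<psi>_def[abs_def] o_def)
  next
    fix U V f h
    assume f: "f \<in> Hom C U V" and h: "h \<in> Hom C V (B \<otimes> R)"
    note [simp] = HomD[OF f] HomD[OF h] Hom_obj[OF f]
    let ?k = "\<delta> B \<cdot> (counit B \<cdot> (h \<boxtimes> \<i>\<d> A))"
    have k: "?k \<in> Hom C (V \<otimes> A) ((B\<^sup>\<star>)\<^sup>\<star>)" and fA: "f \<boxtimes> \<i>\<d> A \<in> Hom C (U \<otimes> A) (V \<otimes> A)"
      by (auto intro: HomI)
    have pk: "\<pi> (V \<otimes> A) (B\<^sup>\<star>) ?k \<in> Hom C ((V \<otimes> A) \<otimes> B\<^sup>\<star>) (\<one>\<^sup>\<star>)"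
      by (simp add: pi_hom k)
    note [simp] = HomD[OF pk]
    have "(h \<cdot> f) \<boxtimes> \<i>\<d> A = (h \<boxtimes> \<i>\<d> A) \<cdot> (f \<boxtimes> \<i>\<d> A)"
      by (simp add: interchange)
    then have "\<psi> U (h \<cdot> f) = \<pi> (U \<otimes> A) (B\<^sup>\<star>) (?k \<cdot> (f \<boxtimes> \<i>\<d> A)) \<cdot> \<alpha> U A (B\<^sup>\<star>)"
      by (simp add: \<psi>_def comp_assoc_arr)
    \<comment> \<open>Naturality of \<open>\<pi>\<close> in its first object extracts
      \<open>f \<boxtimes> \<i>\<d> A\<close>; naturality of \<open>\<alpha>\<close> next turns it
      into the action of \<open>f\<close> on the presheaf.\<close>
    also have "\<dots> = \<pi> (V \<otimes> A) (B\<^sup>\<star>) ?k \<cdot> (((f \<boxtimes> \<i>\<d> A) \<boxtimes> \<i>\<d> (B\<^sup>\<star>)) \<cdot> \<alpha> U A (B\<^sup>\<star>))"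
      using pi_natural_left[OF fA k] by (simp add: comp_assoc_arr)
    also have "\<dots> = \<psi> V h \<cdot> (f \<boxtimes> \<i>\<d> (A \<otimes> B\<^sup>\<star>))"
      using assoc_natural[OF f id_hom id_hom, of A "B\<^sup>\<star>"]
      by (simp add: \<psi>_def comp_assoc_arr tensor_id)
    finally show "\<psi> U (h \<cdot> f) = \<psi> V h \<cdot> (f \<boxtimes> \<i>\<d> (A \<otimes> B\<^sup>\<star>))" .
  qed (auto simp: pi_natural_left)
qed

end

theorem mainTheorem3:
  fixes C :: "('o, 'a, 'm) star_category_scheme" (structure)
    and A B :: 'o
  assumes "condition_C C"
    and "A \<in> Obj (Cb C)"
    and "B \<in> Obj (Cb C)"
  shows "(A \<otimes> B\<^sup>\<star>)\<^sup>\<star> \<cong> B \<otimes> A\<^sup>\<star>"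
proof -
  obtain b d where "right_dual C A (A\<^sup>\<star>) b d"
    using assms(2) by (auto simp: Cb_def full_subcategory_def)
  moreover have "B \<in> Obj C"
    using assms(3) by (auto simp: Cb_def full_subcategory_def)
  ultimately show ?thesis
    using condition_C.star_tensor_star_isomorphic[OF assms(1)] by blast
qed

end
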